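(* Let $\kappa=2$, and for $n\ge1$ let $\mathcal{E}_n=\mathcal{E}_n(\kappa)$ be the sequence of energies defined in the context. Then $\mathcal{E}_n=\dfrac{2}{n+2}$ for all $n\in\mathbb{N}^*$.
   Context: $\mathbb{N}^*=\{1,2,\dots\}$. $T_\kappa$ is the Chebyshev polynomial of the first kind of degree $\kappa$ (so $T_2(x)=2x^2-1$). For $\kappa\ge2$ let $J_2(\kappa)=(2\cos(\pi/\kappa),1+\cos(\pi/\kappa))$. For each $n\in\mathbb{N}^*$ the number $\mathcal{E}_n=\mathcal{E}_n(\kappa)\in J_2(\kappa)$ is the energy component of the unique real solution $(\mathcal{E}_n,X_0,X_1,\dots,X_{n+1})$ with $\mathcal{E}_n\in J_2(\kappa)$ of the following system. If $n$ is odd: $T_\kappa(X_q)=T_\kappa(X_{n-q})$ for $q=0,1,\dots,(n-1)/2$; $X_{n-q}=\mathcal{E}_n-X_{1+q}$ for $q=-1,0,\dots,(n-1)/2$; and $\mathcal{E}_n-1=X_0<X_1<\dots<X_{(n-1)/2}<\cos(\pi/\kappa)<X_{(n+1)/2}<\dots<X_n<X_{n+1}=1$. If $n$ is even: $T_\kappa(X_q)=T_\kappa(X_{n-q})$ for $q=0,1,\dots,n/2-1$; $X_{n-q}=\mathcal{E}_n-X_{1+q}$ for $q=-1,0,\dots,n/2-1$; and $\mathcal{E}_n-1=X_0<X_1<\dots<X_{n/2}=\cos(\pi/\kappa)<X_{n/2+1}<\dots<X_n<X_{n+1}=1$. *)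

theory Defs
  imports "HOL-Analysis.Analysis" "HOL-Computational_Algebra.Polynomial"
begin

text \<open>Chebyshev polynomials of the first kind.\<close>

fun chebyshev_T :: "nat \<Rightarrow> real poly" where
  "chebyshev_T 0 = 1"
| "chebyshev_T (Suc 0) = [:0, 1:]"
| "chebyshev_T (Suc (Suc k)) = 2 * [:0, 1:] * chebyshev_T (Suc k) - chebyshev_T k"

definition J2 :: "nat \<Rightarrow> real set" where
  "J2 \<kappa> = {2 * cos (pi / real \<kappa>) <..< 1 + cos (pi / real \<kappa>)}"

text \<open>
  The points \<open>X\<^sub>0, \<dots>, X\<^sub>n\<^sub>+\<^sub>1\<close> are a family indexed by the integers \<open>0, \<dots>, n + 1\<close>. Integer indices
  allow the symmetry equations to range over \<open>q = -1, 0, \<dots>\<close> without truncated subtraction.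
\<close>

definition odd_system :: "nat \<Rightarrow> int \<Rightarrow> real \<Rightarrow> (int \<Rightarrow> real) \<Rightarrow> bool" where
  "odd_system \<kappa> n E X \<longleftrightarrow>
     (\<forall>q\<in>{0..(n - 1) div 2}. poly (chebyshev_T \<kappa>) (X q) = poly (chebyshev_T \<kappa>) (X (n - q))) \<and>
     (\<forall>q\<in>{-1..(n - 1) div 2}. X (n - q) = E - X (1 + q)) \<and>
     X 0 = E - 1 \<and>
     (\<forall>q\<in>{0..<(n - 1) div 2}. X q < X (q + 1)) \<and>
     X ((n - 1) div 2) < cos (pi / real \<kappa>) \<and>
     cos (pi / real \<kappa>) < X ((n + 1) div 2) \<and>
     (\<forall>q\<in>{(n + 1) div 2..n}. X q < X (q + 1)) \<and>
     X (n + 1) = 1"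

definition even_system :: "nat \<Rightarrow> int \<Rightarrow> real \<Rightarrow> (int \<Rightarrow> real) \<Rightarrow> bool" where
  "even_system \<kappa> n E X \<longleftrightarrow>
     (\<forall>q\<in>{0..n div 2 - 1}. poly (chebyshev_T \<kappa>) (X q) = poly (chebyshev_T \<kappa>) (X (n - q))) \<and>
     (\<forall>q\<in>{-1..n div 2 - 1}. X (n - q) = E - X (1 + q)) \<and>
     X 0 = E - 1 \<and>
     (\<forall>q\<in>{0..<n div 2}. X q < X (q + 1)) \<and>
     X (n div 2) = cos (pi / real \<kappa>) \<and>
     (\<forall>q\<in>{n div 2..n}. X q < X (q + 1)) \<and>
     X (n + 1) = 1"

text \<open>
  A solution is a finite tuple \<open>(E, X\<^sub>0, \<dots>, X\<^sub>n\<^sub>+\<^sub>1)\<close>; extensionality makes functions on the index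
  range correspond one-to-one to such tuples, so that uniqueness has its usual meaning.
\<close>

definition is_solution :: "nat \<Rightarrow> nat \<Rightarrow> real \<times> (int \<Rightarrow> real) \<Rightarrow> bool" where
  "is_solution \<kappa> n = (\<lambda>(E, X).
     E \<in> J2 \<kappa> \<and> X \<in> extensional {0..int n + 1} \<and>
     (if odd n then odd_system \<kappa> (int n) E X else even_system \<kappa> (int n) E X))"

definition energy :: "nat \<Rightarrow> nat \<Rightarrow> real" where
  "energy \<kappa> n = fst (THE s. is_solution \<kappa> n s)"

end

theory Submission
  imports Defs
begin

text \<open>
  For \<open>\<kappa> = 2\<close> the threshold \<open>cos (pi / \<kappa>)\<close> is \<open>0\<close> and \<open>T\<^sub>2 x = 2 x\<^sup>2 - 1\<close>, so
  \<open>T\<^sub>2 x = T\<^sub>2 y\<close> means \<open>y = x\<close> or \<open>y = -x\<close>. The order conditions put \<open>X\<^sub>q\<close> and its partner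
  \<open>X\<^sub>n\<^sub>-\<^sub>q\<close> on opposite sides of \<open>0\<close>, which leaves \<open>X\<^sub>n\<^sub>-\<^sub>q = -X\<^sub>q\<close>. Combined with the second
  family of equations, \<open>X\<^sub>n\<^sub>-\<^sub>q = E - X\<^sub>q\<^sub>+\<^sub>1\<close>, this becomes the recursion
  \<open>X\<^sub>q\<^sub>+\<^sub>1 = X\<^sub>q + E\<close> with \<open>X\<^sub>0 = E - 1\<close>. The points of the left half thus form the arithmetic
  progression \<open>X\<^sub>j = (j + 1) E - 1\<close>, and antisymmetry carries the formula over to the right half.
  The condition at the midpoint (\<open>X\<^sub>n\<^sub>/\<^sub>2 = 0\<close> for even \<open>n\<close>, two middle points opposite to each
  other for odd \<open>n\<close>) then says \<open>(n + 2) E = 2\<close>.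

  Conversely this progression satisfies the system of either parity, and \<open>n \<ge> 1\<close> is what makes
  \<open>E < 1\<close>, that is, \<open>E \<in> J\<^sub>2\<close>. The system therefore has exactly one solution, and the description that defines the energy denotes it.
\<close>

lemma poly_chebyshev_T_2: "poly (chebyshev_T 2) x = 2 * x\<^sup>2 - 1"
  by (simp add: numeral_2_eq_2 power2_eq_square)

text \<open>
  \<open>T\<^sub>2\<close> is even and injective on each half line; opposite signs exclude the solution \<open>y = x\<close>.
\<close>
lemma chebyshev_T_2_eq_opposite_signs:
  assumes "poly (chebyshev_T 2) x = poly (chebyshev_T 2) y" "x < 0" "0 < y"
  shows "y = - x"
  using assms by (auto simp: poly_chebyshev_T_2 power2_eq_iff)

lemma stepwise_increasing_less:
  fixes X :: "int \<Rightarrow> real"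
  assumes step: "\<forall>q\<in>{a..<b}. X q < X (q + 1)" and "a \<le> i" "i < j" "j \<le> b"
  shows "X i < X j"
  using \<open>i < j\<close> \<open>j \<le> b\<close>
proof (induction j rule: int_gr_induct)
  case base
  then show ?case using step \<open>a \<le> i\<close> by auto
next
  case (step j)
  then have "X i < X j" "X j < X (j + 1)" using assms(1,2) by auto
  then show ?case by linarith
qed

lemma arithmetic_progression_of_step:
  fixes X :: "int \<Rightarrow> real"
  assumes "X 0 = E - 1" and step: "\<And>q. 0 \<le> q \<Longrightarrow> q < k \<Longrightarrow> X (q + 1) = X q + E"
    and "0 \<le> j" "j \<le> k"
  shows "X j = (real_of_int j + 1) * E - 1"
  using \<open>0 \<le> j\<close> \<open>j \<le> k\<close>
proof (induction j rule: int_ge_induct)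
  case base
  then show ?case using assms(1) by simp
next
  case (step j)
  then show ?case using assms(2)[of j] by (simp add: algebra_simps)
qed

definition equidistant_points :: "nat \<Rightarrow> int \<Rightarrow> real" where
  "equidistant_points n =
     restrict (\<lambda>j. (real_of_int j + 1) * (2 / (real n + 2)) - 1) {0..int n + 1}"

lemma J2_2: "J2 2 = {0<..<1}"
  by (simp add: J2_def)

text \<open>
  The two parities enter only through the midpoint. What they share is that the left half,
  up to an index \<open>k\<close> with \<open>n \<le> 2 k\<close>, is a progression with step \<open>E\<close>, that the right half is
  its reflection, and that \<open>(n + 2) E = 2\<close>; this already fixes all the points.
\<close>
lemma points_determined:
  fixes X :: "int \<Rightarrow> real"
  assumes E: "(real n + 2) * E = 2"
    and left: "\<And>j. 0 \<le> j \<Longrightarrow> j \<le> k \<Longrightarrow> X j = (real_of_int j + 1) * E - 1"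
    and refl: "\<And>q. 0 \<le> q \<Longrightarrow> q < k \<Longrightarrow> X (int n - q) = - X q"
    and "int n \<le> 2 * k" and last: "X (int n + 1) = 1"
    and ext: "X \<in> extensional {0..int n + 1}"
  shows "(E, X) = (2 / (real n + 2), equidistant_points n)"
proof -
  have E': "E = 2 / (real n + 2)" using E by (simp add: field_simps)
  have pts: "X j = (real_of_int j + 1) * E - 1" if "0 \<le> j" "j \<le> int n + 1" for j
  proof -
    consider "j \<le> k" | "k < j" "j \<le> int n" | "j = int n + 1" using \<open>j \<le> int n + 1\<close> by linarith
    then show ?thesis
    proof cases
      case 2
      have "X j = - X (int n - j)" using refl[of "int n - j"] 2 \<open>int n \<le> 2 * k\<close> by simp
      also have "\<dots> = 1 - (real n - real_of_int j + 1) * E"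
        using left[of "int n - j"] 2 \<open>int n \<le> 2 * k\<close> by simp
      finally show ?thesis using E by (simp add: algebra_simps)
    next
      case 3
      then show ?thesis using last E by (simp add: algebra_simps)
    qed (use left that in auto)
  qed
  have "X = equidistant_points n"
    by (rule extensionalityI[OF ext]) (use pts E' in \<open>auto simp: equidistant_points_def\<close>)
  then show ?thesis using E' by simp
qed

lemma even_system_unique:
  assumes sys: "even_system 2 (int n) E X" and "even n"
    and ext: "X \<in> extensional {0..int n + 1}"
  shows "(E, X) = (2 / (real n + 2), equidistant_points n)"
proof -
  obtain m where n: "int n = 2 * m" using \<open>even n\<close> by (metis evenE of_nat_mult of_nat_numeral)
  note S = sys[unfolded even_system_def n, simplified]
  have n_real: "real n = 2 * real_of_int m" using n by linarith
  have refl: "X (2 * m - q) = - X q" if "0 \<le> q" "q < m" for q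
  proof (rule chebyshev_T_2_eq_opposite_signs)
    show "X q < 0" using stepwise_increasing_less[of 0 m X q m] S that by auto
    show "0 < X (2 * m - q)"
      using stepwise_increasing_less[of m "2 * m + 1" X m "2 * m - q"] S that by auto
  qed (use S that in auto)
  have step: "X (q + 1) = X q + E" if "0 \<le> q" "q < m" for q
  proof -
    have "X (2 * m - q) = E - X (1 + q)" using S that by auto
    then show ?thesis using refl[OF that] by (simp add: add.commute)
  qed
  have left: "X j = (real_of_int j + 1) * E - 1" if "0 \<le> j" "j \<le> m" for j
    by (rule arithmetic_progression_of_step[where k = m]) (use S step that in auto)
  have "X m = 0" using S by simp
  then have "(real n + 2) * E = 2" using left[of m] n n_real by (simp add: algebra_simps)
  then show ?thesis
    by (rule points_determined[where k = m]) (use left refl S ext n in auto)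
qed

lemma odd_system_unique:
  assumes sys: "odd_system 2 (int n) E X" and "odd n"
    and ext: "X \<in> extensional {0..int n + 1}"
  shows "(E, X) = (2 / (real n + 2), equidistant_points n)"
proof -
  obtain m where n: "int n = 2 * m + 1" using \<open>odd n\<close> by (metis oddE even_of_nat)
  have halves: "(2 * m + 1 - 1) div 2 = m" "(2 * m + 1 + 1) div 2 = m + 1" by auto
  note S = sys[unfolded odd_system_def n halves, simplified]
  have n_real: "real n = 2 * real_of_int m + 1" and "0 \<le> m" using n by linarith+
  have refl: "X (2 * m + 1 - q) = - X q" if "0 \<le> q" "q \<le> m" for q
  proof (rule chebyshev_T_2_eq_opposite_signs)
    show "X q < 0" using stepwise_increasing_less[of 0 m X q m] S that by (cases "q = m") auto
    show "0 < X (2 * m + 1 - q)"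
      using stepwise_increasing_less[of "m + 1" "2 * m + 2" X "m + 1" "2 * m + 1 - q"] S that
      by (cases "q = m") (auto simp: add.commute)
  qed (use S that in auto)
  have step: "X (q + 1) = X q + E" if "0 \<le> q" "q < m + 1" for q
  proof -
    have "X (2 * m + 1 - q) = E - X (1 + q)" using S that by auto
    then show ?thesis using refl[of q] that by (simp add: add.commute)
  qed
  have left: "X j = (real_of_int j + 1) * E - 1" if "0 \<le> j" "j \<le> m + 1" for j
    by (rule arithmetic_progression_of_step[where k = "m + 1"]) (use S step that in auto)
  \<comment> \<open>The two middle points are opposite to each other at distance \<open>E\<close>, hence \<open>X m = - E / 2\<close>.\<close>
  have "X (m + 1) = - X m" using refl[of m] \<open>0 \<le> m\<close> by (simp add: algebra_simps)
  then have "(real n + 2) * E = 2"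
    using left[of m] left[of "m + 1"] \<open>0 \<le> m\<close> n_real by (simp add: algebra_simps)
  then show ?thesis
    by (rule points_determined[where k = "m + 1"]) (use left refl S ext n in auto)
qed

text \<open>
  Reflection at \<open>0\<close> maps the \<open>j\<close>-th point to the \<open>(n - j)\<close>-th one; this, the constant gap
  and \<open>(n + 2) E = 2\<close> give all the equations of both systems.
\<close>
lemma equidistant_points_is_solution:
  assumes "n \<ge> 1"
  shows "is_solution 2 n (2 / (real n + 2), equidistant_points n)"
proof -
  define E where "E = 2 / (real n + 2)"
  let ?X = "equidistant_points n"
  have E: "(real n + 2) * E = 2" "E > 0" by (auto simp: E_def field_simps)
  have "E < 1" using assms by (simp add: E_def)
  have X: "?X j = (real_of_int j + 1) * E - 1" if "0 \<le> j" "j \<le> int n + 1" for j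
    using that by (simp add: equidistant_points_def E_def)
  have refl: "?X (int n - q) = - ?X q" if "0 \<le> q" "q \<le> int n" for q
    using E(1) that by (simp add: X algebra_simps)
  have T: "poly (chebyshev_T 2) (?X q) = poly (chebyshev_T 2) (?X (int n - q))"
    if "0 \<le> q" "q \<le> int n" for q
    using that by (simp add: poly_chebyshev_T_2 refl)
  have sym: "?X (int n - q) = E - ?X (1 + q)" if "-1 \<le> q" "q \<le> int n" for q
    using E(1) that by (simp add: X algebra_simps)
  have inc: "?X q < ?X (q + 1)" if "0 \<le> q" "q \<le> int n" for q
    using \<open>E > 0\<close> that by (simp add: X)
  have first: "?X 0 = E - 1" and last: "?X (int n + 1) = 1"
    using E(1) by (simp_all add: X algebra_simps)
  have "odd_system 2 (int n) E ?X" if "odd n"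
  proof -
    obtain m where n: "int n = 2 * m + 1" using \<open>odd n\<close> by (metis oddE even_of_nat)
    then have "0 \<le> m" by linarith
    have halves: "(int n - 1) div 2 = m" "(int n + 1) div 2 = m + 1" using n by auto
    have "?X (m + 1) = - ?X m" using refl[of m] n \<open>0 \<le> m\<close> by (simp add: algebra_simps)
    moreover have "?X m < ?X (m + 1)" using inc n \<open>0 \<le> m\<close> by simp
    ultimately have "?X m < 0" "0 < ?X (m + 1)" by linarith+
    then show ?thesis
      unfolding odd_system_def halves
      using T sym inc first last n \<open>0 \<le> m\<close> by auto
  qed
  moreover have "even_system 2 (int n) E ?X" if "even n"
  proof -
    obtain m where n: "int n = 2 * m" using \<open>even n\<close> by (metis evenE of_nat_mult of_nat_numeral)
    then have "0 \<le> m" by linarith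
    have half: "int n div 2 = m" using n by auto
    have "?X m = 0" using refl[of m] n \<open>0 \<le> m\<close> by simp
    then show ?thesis
      unfolding even_system_def half
      using T sym inc first last n \<open>0 \<le> m\<close> by auto
  qed
  moreover have "?X \<in> extensional {0..int n + 1}" by (simp add: equidistant_points_def)
  ultimately show ?thesis
    using \<open>E > 0\<close> \<open>E < 1\<close> unfolding is_solution_def by (simp add: E_def J2_2)
qed

lemma is_solution_2_iff:
  assumes "n \<ge> 1"
  shows "is_solution 2 n s \<longleftrightarrow> s = (2 / (real n + 2), equidistant_points n)"
proof
  assume "is_solution 2 n s"
  then show "s = (2 / (real n + 2), equidistant_points n)"
    using even_system_unique odd_system_unique
    by (cases s) (auto simp: is_solution_def split: if_splits)
qed (use equidistant_points_is_solution[OF assms] in simp)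

theorem proposition1p8:
  fixes \<kappa> n :: nat
  assumes "\<kappa> = 2" and "n \<ge> 1"
  shows "energy \<kappa> n = 2 / (real n + 2)"
  using assms by (simp add: energy_def is_solution_2_iff)

end
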